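(* Let $\mathrm{PoA}(d)$ be the (asymptotic) price of anarchy of the selfish $d$-hypercube bin packing game. There is an absolute constant $d_0$ such that for all $d\geq d_0$ we have $\mathrm{PoA}(d)\geq \dfrac{d}{5\log d}$.
   Context: Selfish $d$-hypercube bin packing game: a game $G$ consists of a finite set of $d$-dimensional hypercubes (the players/items), each of side length at most $1$, to be packed into unit bins $[0,1]^d$ (axis-parallel, pairwise non-overlapping within a bin). A configuration is a feasible assignment of the items to bins (equivalently, a packing of the items into bins). The cost of an item is its volume divided by the total volume of the items in its bin. An item may move to another bin only if the items of that bin together with it can be feasibly packed into a unit bin. A configuration is a (pure) Nash equilibrium if no single item can move to another bin and strictly decrease its cost while all other items stay put. The social cost ${\rm SC}(p)$ of a configuration $p$ is the number of used (nonempty) bins, and ${\rm OPT}(G)$ is the minimum social cost over all configurations. Writing $\mathcal{N}(G)$ for the set of Nash equilibria of $G$ and $\mathcal{G}_d$ for the class of all such games with $d$-dimensional items, the asymptotic price of anarchy is $\mathrm{PoA}(d)=\limsup_{m\to\infty}\sup_{G\in\mathcal{G}_d,\,{\rm OPT}(G)=m}\max_{p\in\mathcal{N}(G)}{\rm SC}(p)/m$. Here $\log$ is the natural logarithm. *)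

theory Defs
  imports Complex_Main "HOL-Library.FuncSet" "HOL-Library.Disjoint_Sets"
    "HOL-Library.Extended_Real" "HOL-Library.Liminf_Limsup"
begin

text \<open>
  Points of d-dimensional space are extensional functions on \<open>{..<d}\<close>, so that the dimension
  can be quantified over inside a formula.
\<close>

definition closed_cube :: "nat \<Rightarrow> (nat \<Rightarrow> real) \<Rightarrow> real \<Rightarrow> (nat \<Rightarrow> real) set" where
  "closed_cube d x s = (\<Pi>\<^sub>E k\<in>{..<d}. {x k .. x k + s})"

definition open_cube :: "nat \<Rightarrow> (nat \<Rightarrow> real) \<Rightarrow> real \<Rightarrow> (nat \<Rightarrow> real) set" where
  "open_cube d x s = (\<Pi>\<^sub>E k\<in>{..<d}. {x k <..< x k + s})"

definition unit_bin :: "nat \<Rightarrow> (nat \<Rightarrow> real) set" where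
  "unit_bin d = (\<Pi>\<^sub>E k\<in>{..<d}. {0..1})"

text \<open>
  A game is given by the list of side lengths of its items (equal cubes may occur repeatedly);
  the items are the indices \<open>i < length G\<close>.
\<close>

type_synonym game = "real list"

definition games :: "game set" where
  "games = {G. set G \<subseteq> {0<..1}}"

definition items :: "game \<Rightarrow> nat set" where
  "items G = {..<length G}"

definition volume :: "nat \<Rightarrow> game \<Rightarrow> nat \<Rightarrow> real" where
  "volume d G i = (G ! i) ^ d"

text \<open>
  Items may touch along their boundaries, hence only the interiors are required to be disjoint.
\<close>

definition packable :: "nat \<Rightarrow> game \<Rightarrow> nat set \<Rightarrow> bool" where
  "packable d G S \<longleftrightarrow>
    (\<exists>x :: nat \<Rightarrow> nat \<Rightarrow> real.
      (\<forall>i\<in>S. closed_cube d (x i) (G ! i) \<subseteq> unit_bin d) \<and>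
      disjoint_family_on (\<lambda>i. open_cube d (x i) (G ! i)) S)"

text \<open>
  Bins are labelled by natural numbers, and \<open>p i\<close> is the bin of item \<open>i\<close>.
\<close>

definition bin_items :: "game \<Rightarrow> (nat \<Rightarrow> nat) \<Rightarrow> nat \<Rightarrow> nat set" where
  "bin_items G p b = {i \<in> items G. p i = b}"

definition configurations :: "nat \<Rightarrow> game \<Rightarrow> (nat \<Rightarrow> nat) set" where
  "configurations d G = {p. \<forall>b. packable d G (bin_items G p b)}"

definition cost :: "nat \<Rightarrow> game \<Rightarrow> (nat \<Rightarrow> nat) \<Rightarrow> nat \<Rightarrow> real" where
  "cost d G p i = volume d G i / (\<Sum>j\<in>bin_items G p (p i). volume d G j)"

text \<open>
  The items of the target bin may be rearranged to make room for the moving item.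
\<close>

definition nash_equilibria :: "nat \<Rightarrow> game \<Rightarrow> (nat \<Rightarrow> nat) set" where
  "nash_equilibria d G =
    {p \<in> configurations d G.
      \<not> (\<exists>i\<in>items G. \<exists>b. b \<noteq> p i \<and>
            packable d G (insert i (bin_items G p b)) \<and>
            cost d G (p(i := b)) i < cost d G p i)}"

definition social_cost :: "game \<Rightarrow> (nat \<Rightarrow> nat) \<Rightarrow> nat" where
  "social_cost G p = card (p ` items G)"

definition OPT :: "nat \<Rightarrow> game \<Rightarrow> nat" where
  "OPT d G = (INF p\<in>configurations d G. social_cost G p)"

text \<open>
  The social cost is at most the number of items, so the inner supremum is a maximum over
  finitely many values. The extended reals avoid having to presuppose that the outer supremum
  and the limit superior are finite.
\<close>

definition PoA :: "nat \<Rightarrow> ereal" where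
  "PoA d =
    limsup (\<lambda>m. SUP G\<in>{G \<in> games. OPT d G = m}.
                  SUP p\<in>nash_equilibria d G. ereal (real (social_cost G p) / real m))"

end

theory Submission
  imports Defs "HOL-Library.Nat_Bijection" "HOL-Real_Asymp.Real_Asymp"
begin

text \<open>
  Take cubes of types \<open>k = 2, \<dots>, S\<close> with side slightly above \<open>1/k\<close>. A bin holds at most
  \<open>(k - 1) ^ d\<close> cubes of type \<open>k\<close>, and filling bins homogeneously up to this bound is a Nash
  equilibrium: a cube never fits into a full bin of cubes that are not larger, and a full bin of
  larger cubes has too little volume to attract it. A much better packing puts almost
  \<open>(k - 1) ^ d\<close> cubes of every type \<open>k\<close> into the same bin, which makes the price of anarchy at
  least about \<open>S\<close>.

  To this end choose sets \<open>T k\<close> of coordinates. In each coordinate the cubes of type \<open>k\<close> occupy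
  one of \<open>k - 1\<close> consecutive slots aligned to the left, except that in the coordinates from
  \<open>T k\<close> the last slot is aligned to the right. For \<open>j < k\<close> a cube of type \<open>k\<close> is disjoint from
  all cubes of type \<open>j\<close> as soon as it uses the last slot in some coordinate from \<open>T k - T j\<close>,
  a condition on the cube of type \<open>k\<close> alone. A random cube violates it with probability at most
  \<open>(1 - 1/S) ^ card (T k - T j)\<close>. Walsh functions yield sets with \<open>card (T k - T j)\<close> about \<open>d/4\<close>,
  so that \<open>S\<close> may be as large as \<open>d / (c ln d)\<close> for any \<open>c > 4\<close>; the proof takes \<open>c = 9/2\<close>.
\<close>

section \<open>Packings of cubes\<close>

lemma closed_cube_subset_unit_bin_iff:
  assumes "0 \<le> s"
  shows "closed_cube d x s \<subseteq> unit_bin d \<longleftrightarrow> (\<forall>k<d. 0 \<le> x k \<and> x k + s \<le> 1)"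
  using assms unfolding closed_cube_def unit_bin_def subset_PiE
  by (auto simp: PiE_eq_empty_iff)

lemma open_cube_disjoint:
  assumes "i < d" "x i + s \<le> y i"
  shows "open_cube d x s \<inter> open_cube d y t = {}"
proof -
  have "f i < y i" if "f \<in> open_cube d x s" for f
    using that assms by (force simp: open_cube_def PiE_iff)
  moreover have "y i < f i" if "f \<in> open_cube d y t" for f
    using that assms by (force simp: open_cube_def PiE_iff)
  ultimately show ?thesis by (meson disjoint_iff less_asym)
qed

lemma packable_mono:
  assumes "packable d G B" "A \<subseteq> B"
  shows "packable d G A"
  using assms unfolding packable_def by (meson disjoint_family_on_mono subset_iff)

text \<open>An interval longer than the mesh \<open>1 / l\<close> contains the first grid point to
  the right of its left end. The bounds \<open>0 \<le> a\<close> and \<open>a + s \<le> 1\<close>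
  exclude the grid points 0 and 1, which leaves \<open>l - 1\<close> choices.\<close>

lemma grid_point_in_interval:
  fixes a s :: real and l :: nat
  assumes "0 \<le> a" "a + s \<le> 1" "1 / real l < s" "0 < l"
  shows "\<exists>j\<in>{1..<l}. a < real j / real l \<and> real j / real l < a + s"
proof -
  \<comment> \<open>Floor plus one instead of the ceiling: \<open>a\<close> may itself be a grid
    point, and the inequality must be strict.\<close>
  define j where "j = nat (\<lfloor>a * real l\<rfloor> + 1)"
  have j: "real j = of_int \<lfloor>a * real l\<rfloor> + 1"
    using assms by (simp add: j_def)
  have lo: "a * real l < real j" and hi: "real j \<le> a * real l + 1"
    unfolding j by linarith+
  have "1 < s * real l" using assms by (simp add: field_simps)
  then have "real j < (a + s) * real l" using hi by (simp add: algebra_simps)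
  moreover have "(a + s) * real l \<le> real l" using assms by (simp add: mult_left_le_one_le)
  ultimately have "j < l" by linarith
  moreover have "0 \<le> \<lfloor>a * real l\<rfloor>" using assms by simp
  then have "1 \<le> j" unfolding j_def by linarith
  ultimately show ?thesis
    using lo \<open>real j < (a + s) * real l\<close> assms(4)
    by (intro bexI[of _ j]) (auto simp: field_simps)
qed

text \<open>
  The interior of a cube of side greater than \<open>1/l\<close> inside the unit bin contains one of the
  \<open>(l - 1) ^ d\<close> interior points of the grid of mesh \<open>1/l\<close>.
\<close>

lemma packable_card_le:
  assumes "packable d G A" "\<And>i. i \<in> A \<Longrightarrow> 1 / real l < G ! i" "0 < l"
  shows "card A \<le> (l - 1) ^ d"
proof -
  obtain x where x: "\<And>i. i \<in> A \<Longrightarrow> closed_cube d (x i) (G ! i) \<subseteq> unit_bin d"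
    and disj: "disjoint_family_on (\<lambda>i. open_cube d (x i) (G ! i)) A"
    using assms(1) unfolding packable_def by blast
  have pos: "0 \<le> G ! i" if "i \<in> A" for i
    using assms(2)[OF that] by (smt (verit) of_nat_0_le_iff zero_le_divide_1_iff)
  have "\<exists>j\<in>{1..<l}. x i k < real j / real l \<and> real j / real l < x i k + G ! i"
    if "i \<in> A" "k < d" for i k
  proof (rule grid_point_in_interval)
    show "0 \<le> x i k" "x i k + G ! i \<le> 1"
      using x[OF that(1)] that(2) closed_cube_subset_unit_bin_iff[OF pos[OF that(1)]] by blast+
  qed (use assms that in auto)
  then obtain g where g: "\<And>i k. i \<in> A \<Longrightarrow> k < d \<Longrightarrow> g i k \<in> {1..<l} \<and>
      x i k < real (g i k) / real l \<and> real (g i k) / real l < x i k + G ! i"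
    by metis
  define h where "h i = (\<lambda>k\<in>{..<d}. g i k)" for i
  have mem: "(\<lambda>k\<in>{..<d}. real (h i k) / real l) \<in> open_cube d (x i) (G ! i)" if "i \<in> A" for i
    using g[OF that] unfolding open_cube_def h_def by auto
  \<comment> \<open>A common grid point would lie in the interiors of both cubes.\<close>
  have "inj_on h A"
  proof (rule inj_onI)
    fix i j assume ij: "i \<in> A" "j \<in> A" "h i = h j"
    then have "open_cube d (x i) (G ! i) \<inter> open_cube d (x j) (G ! j) \<noteq> {}"
      using mem[of i] mem[of j] by auto
    then show "i = j"
      using disj ij unfolding disjoint_family_on_def by blast
  qed
  moreover have "h ` A \<subseteq> {..<d} \<rightarrow>\<^sub>E {1..<l}"
    using g by (intro image_subsetI) (simp add: h_def restrict_PiE_iff)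
  ultimately have "card A \<le> card ({..<d} \<rightarrow>\<^sub>E {1..<l})"
    by (intro card_inj_on_le) (auto intro: finite_PiE)
  then show ?thesis by (simp add: card_PiE)
qed

section \<open>Separated codes of cubes\<close>

locale cube_codes =
  fixes d S :: nat and T :: "nat \<Rightarrow> nat set"
  assumes d_ge: "2 \<le> d" and S_ge: "2 \<le> S"
begin

text \<open>The excess over \<open>1 / k\<close> must be positive for the counting bound, yet so
  small that \<open>k - 1\<close> cubes of type \<open>k\<close> and one cube of a larger type still
  fit side by side; a relative excess of order \<open>1 / S^2\<close> achieves both.\<close>

definition side :: "nat \<Rightarrow> real" where
  "side k = (1 + 1 / (real S)\<^sup>2) / real k"

definition words :: "nat \<Rightarrow> (nat \<Rightarrow> nat) set" where
  "words k = ({..<d} \<rightarrow>\<^sub>E {..<k - 1})"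

text \<open>Slots are numbered from 0, so \<open>k - 2\<close> is the last one. The quantifier over
  \<open>j\<close> makes one word separate its cube from all cubes of all smaller types at
  once.\<close>

definition code :: "nat \<Rightarrow> (nat \<Rightarrow> nat) set" where
  "code k = {v \<in> words k. \<forall>j\<in>{2..<k}. \<exists>i<d. i \<in> T k - T j \<and> v i = k - 2}"

definition position :: "nat \<Rightarrow> (nat \<Rightarrow> nat) \<Rightarrow> nat \<Rightarrow> real" where
  "position k w i = (if i \<in> T k \<and> w i = k - 2 then 1 - side k else real (w i) * side k)"

lemma finite_words [simp]: "finite (words k)"
  by (simp add: words_def finite_PiE)

lemma card_words: "card (words k) = (k - 1) ^ d"
  by (simp add: words_def card_PiE)

lemma code_subset: "code k \<subseteq> words k"
  by (auto simp: code_def)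

lemma finite_code [simp]: "finite (code k)"
  by (rule finite_subset[OF code_subset]) simp

section \<open>Arithmetic of the side lengths\<close>

lemma side_gt: "2 \<le> k \<Longrightarrow> 1 / real k < side k"
  using S_ge by (simp add: side_def field_simps)

lemma side_pos: "2 \<le> k \<Longrightarrow> 0 < side k"
  using side_gt[of k] by (smt (verit) of_nat_0_le_iff zero_le_divide_1_iff)

lemma side_antimono: "2 \<le> k \<Longrightarrow> k \<le> l \<Longrightarrow> side l \<le> side k"
  unfolding side_def by (intro divide_left_mono) auto

text \<open>The worst case is \<open>l = k + 1\<close>. There the unperturbed lengths
  \<open>(k - 1) / k\<close> and \<open>1 / (k + 1)\<close> leave the slack
  \<open>1 / (k * (k + 1))\<close>, which is at least the relative excess \<open>e\<close>.\<close>

lemma side_le_gap: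
  assumes "2 \<le> k" "k < l" "l \<le> S"
  shows "real (k - 1) * side k + side l \<le> 1"
proof -
  define e where "e = 1 / (real S)\<^sup>2"
  have "real k * real (k + 1) \<le> (real S)\<^sup>2"
    unfolding power2_eq_square using assms by (intro mult_mono) auto
  then have e: "e \<le> 1 / (real k * real (k + 1))" "0 \<le> e"
    unfolding e_def using assms by (auto intro!: divide_left_mono)
  have "side l \<le> side (k + 1)" using assms by (intro side_antimono) auto
  then have "real (k - 1) * side k + side l \<le> real (k - 1) * side k + side (k + 1)" by simp
  also have "\<dots> = (1 + e) * (1 - 1 / (real k * real (k + 1)))"
    using assms by (simp add: side_def e_def[symmetric] of_nat_diff divide_simps) (simp add: algebra_simps)
  also have "\<dots> \<le> (1 + e) * (1 - e)"
    using e by (intro mult_left_mono) auto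
  also have "\<dots> \<le> 1" by (simp add: algebra_simps)
  finally show ?thesis .
qed

text \<open>The type \<open>k = S\<close> has no larger neighbour for \<open>side_le_gap\<close>, so
  the room for its slots is computed directly.\<close>

lemma side_slots:
  assumes "2 \<le> k" "k \<le> S"
  shows "real (k - 1) * side k \<le> 1"
proof -
  have "real (k - 1) * (1 + 1 / (real S)\<^sup>2) \<le> real (k - 1) * (1 + 1 / real k)"
    using assms self_le_power[of "real S" 2]
    by (intro mult_left_mono add_left_mono divide_left_mono) auto
  also have "\<dots> \<le> real k"
    using assms by (simp add: of_nat_diff field_simps)
  finally show ?thesis using assms by (simp add: side_def field_simps)
qed

lemma side_le_1: "2 \<le> k \<Longrightarrow> k \<le> S \<Longrightarrow> side k \<le> 1"
  using mult_right_mono[of 1 "real (k - 1)" "side k"] side_slots[of k] side_pos[of k] by linarith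

section \<open>Disjointness of the positioned cubes\<close>

lemma word_less: "w \<in> words k \<Longrightarrow> i < d \<Longrightarrow> w i < k - 1"
  by (auto simp: words_def PiE_iff)

lemma slot_end:
  assumes "2 \<le> k" "j < m"
  shows "real j * side k + side k \<le> real m * side k"
proof -
  have "real j * side k + side k = real (j + 1) * side k" by (simp add: algebra_simps)
  also have "\<dots> \<le> real m * side k"
    using assms side_pos[of k] by (intro mult_right_mono) auto
  finally show ?thesis .
qed

lemma position_in_bin:
  assumes "2 \<le> k" "k \<le> S" "w \<in> words k" "i < d"
  shows "0 \<le> position k w i" "position k w i + side k \<le> 1"
proof -
  show "0 \<le> position k w i"
    using side_le_1[OF assms(1,2)] side_pos[OF assms(1)] by (auto simp: position_def)
  show "position k w i + side k \<le> 1"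
    using slot_end[OF assms(1) word_less[OF assms(3,4)]] side_slots[OF assms(1,2)]
    by (auto simp: position_def)
qed

lemma position_same_type:
  assumes "2 \<le> k" "k \<le> S" "v \<in> words k" "i < d" "u i < v i"
  shows "position k u i + side k \<le> position k v i"
proof -
  have v: "v i < k - 1" using word_less assms by blast
  \<comment> \<open>Only \<open>v\<close> can use the last slot here, and shifting that slot to the
    right moves it away from the slot of \<open>u\<close>.\<close>
  then have u: "u i \<noteq> k - 2" "u i < k - 2" using assms by auto
  have "real (k - 2) * side k + side k \<le> 1"
    using slot_end[OF assms(1), of "k - 2" "k - 1"] side_slots[OF assms(1,2)] u by linarith
  then show ?thesis
    using u slot_end[OF assms(1,5)] slot_end[OF assms(1) u(2)] by (auto simp: position_def)
qed

text \<open>Outside \<open>T j\<close> the cube of type \<open>j\<close> is left-aligned whatever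
  its word is, and the cube of type \<open>k\<close> is flush with the right wall;
  \<open>side_le_gap\<close> keeps them apart.\<close>

lemma position_cross_type:
  assumes "2 \<le> j" "j < k" "k \<le> S" "w \<in> words j" "i < d" "i \<in> T k - T j" "v i = k - 2"
  shows "position j w i + side j \<le> position k v i"
  using slot_end[OF assms(1) word_less[OF assms(4,5)]] side_le_gap[OF assms(1-3)] assms(6,7)
  by (auto simp: position_def)

lemma cubes_same_type_disjoint:
  assumes "2 \<le> k" "k \<le> S" "u \<in> words k" "v \<in> words k" "u \<noteq> v"
  shows "open_cube d (position k u) (side k) \<inter> open_cube d (position k v) (side k) = {}"
proof -
  obtain i where i: "i < d" "u i \<noteq> v i"
    using assms unfolding words_def by (metis PiE_ext lessThan_iff)
  then consider "u i < v i" | "v i < u i" by linarith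
  then show ?thesis
    using open_cube_disjoint[OF i(1)] position_same_type i(1) assms
    by cases (blast, metis Int_commute)
qed

lemma cubes_cross_type_disjoint:
  assumes "2 \<le> j" "j < k" "k \<le> S" "w \<in> words j" "v \<in> code k"
  shows "open_cube d (position j w) (side j) \<inter> open_cube d (position k v) (side k) = {}"
proof -
  obtain i where "i < d" "i \<in> T k - T j" "v i = k - 2"
    using assms by (auto simp: code_def dest!: bspec[of _ _ j])
  then show ?thesis
    using open_cube_disjoint position_cross_type assms by blast
qed

text \<open>Serves both packings: mixed bins, where all words are codewords, and homogeneous bins,
  where the last hypothesis is vacuous and arbitrary words are allowed.\<close>

lemma packable_codes:
  assumes side: "\<And>i. i \<in> A \<Longrightarrow> G ! i = side (\<kappa> i) \<and> \<kappa> i \<in> {2..S} \<and> f i \<in> words (\<kappa> i)"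
    and inj: "inj_on (\<lambda>i. (\<kappa> i, f i)) A"
    and code: "\<And>i j. i \<in> A \<Longrightarrow> j \<in> A \<Longrightarrow> \<kappa> i < \<kappa> j \<Longrightarrow> f j \<in> code (\<kappa> j)"
  shows "packable d G A"
  unfolding packable_def
proof (intro exI[of _ "\<lambda>i. position (\<kappa> i) (f i)"] conjI ballI)
  fix i assume "i \<in> A"
  then show "closed_cube d (position (\<kappa> i) (f i)) (G ! i) \<subseteq> unit_bin d"
    using side[of i] side_pos[of "\<kappa> i"] position_in_bin
    by (auto simp: closed_cube_subset_unit_bin_iff)
next
  have "open_cube d (position (\<kappa> i) (f i)) (G ! i) \<inter> open_cube d (position (\<kappa> j) (f j)) (G ! j) = {}"
    if ij: "i \<in> A" "j \<in> A" "i \<noteq> j" for i j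
  proof -
    have ne: "(\<kappa> i, f i) \<noteq> (\<kappa> j, f j)" using inj ij by (auto dest: inj_onD)
    consider "\<kappa> i = \<kappa> j" | "\<kappa> i < \<kappa> j" | "\<kappa> j < \<kappa> i" by linarith
    then show ?thesis
    proof cases
      case 1
      then show ?thesis using side[OF ij(1)] side[OF ij(2)] ne cubes_same_type_disjoint by auto
    next
      case 2
      then show ?thesis
        using side[OF ij(1)] side[OF ij(2)] code[OF ij(1,2)] cubes_cross_type_disjoint by auto
    next
      case 3
      then show ?thesis
        using side[OF ij(1)] side[OF ij(2)] code[OF ij(2,1)] cubes_cross_type_disjoint
        by (subst Int_commute) auto
    qed
  qed
  then show "disjoint_family_on (\<lambda>i. open_cube d (position (\<kappa> i) (f i)) (G ! i)) A"
    unfolding disjoint_family_on_def by blast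
qed

section \<open>Equilibria with homogeneous bins\<close>

text \<open>
  Volumes of homogeneous bins grow strictly with the type, so that an item which fits into a bin
  of larger cubes does not gain by moving there.
\<close>

lemma move_unprofitable:
  assumes "2 \<le> l" "l < k"
  shows "side k ^ d + real ((l - 1) ^ d) * side l ^ d \<le> real ((k - 1) ^ d) * side k ^ d"
proof -
  define a where "a = real (k - 1)"
  \<comment> \<open>In units of \<open>side k\<close>, the full bins of types \<open>k\<close> and
    \<open>l\<close> have volumes \<open>a ^ d\<close> and \<open>b ^ d\<close>, and the moving cube
    has volume 1.\<close>
  define b where "b = real k * (real (l - 1) / real l)"
  have a: "1 \<le> a" using assms by (simp add: a_def)
  have b0: "0 \<le> b" by (simp add: b_def)
  have "1 / (real k - 1) \<le> 1 / real l" using assms by (intro divide_left_mono) auto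
  then have "real (l - 1) / real l \<le> 1 - 1 / (real k - 1)"
    using assms by (simp add: of_nat_diff diff_divide_distrib)
  then have "b \<le> real k * (1 - 1 / (real k - 1))"
    unfolding b_def by (intro mult_left_mono) auto
  also have "\<dots> = a - 1 / a"
    using assms by (simp add: a_def of_nat_diff field_simps)
  finally have ab: "b \<le> a - 1 / a" .
  have "b ^ (d - 1) \<le> a ^ (d - 1)"
    using ab a b0 by (intro power_mono) (auto intro: order_trans)
  \<comment> \<open>Only one factor \<open>b\<close> is estimated by \<open>a - 1 / a\<close>. Its
    gain \<open>1 / a\<close> is multiplied by \<open>a ^ (d - 1)\<close>, and since
    \<open>d \<ge> 2\<close> this pays for the moving cube.\<close>
  then have "b ^ d \<le> b * a ^ (d - 1)"
    using b0 d_ge by (cases d) (auto intro: mult_left_mono)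
  also have "\<dots> \<le> (a - 1 / a) * a ^ (d - 1)"
    using ab a by (intro mult_right_mono) auto
  also have "\<dots> = a ^ d - a ^ (d - 2)"
  proof -
    obtain n where "d = Suc (Suc n)" using d_ge by (metis Suc_le_D numeral_2_eq_2 Suc_le_mono)
    then show ?thesis using a by (simp add: field_simps)
  qed
  also have "\<dots> \<le> a ^ d - 1" using a by simp
  finally have "side k ^ d * (1 + b ^ d) \<le> side k ^ d * a ^ d"
    using side_pos[of k] assms by (intro mult_left_mono) auto
  moreover have "side k * b = real (l - 1) * side l"
    using assms by (simp add: side_def b_def)
  then have "side k ^ d * b ^ d = real ((l - 1) ^ d) * side l ^ d"
    by (metis power_mult_distrib of_nat_power)
  ultimately show ?thesis by (simp add: algebra_simps a_def)
qed

text \<open>The items are \<open>N\<close> copies of \<open>code k\<close> for every type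
  \<open>k\<close>. One copy of all the codes forms a bin of the optimal packing; in the equilibrium
  each type is regrouped into full homogeneous bins, whose number is an integer by
  divisibility.\<close>

lemma ex_nash_game:
  assumes dvd: "\<And>k. k \<in> {2..S} \<Longrightarrow> (k - 1) ^ d dvd N"
  shows "\<exists>G\<in>games. OPT d G = N \<and> (\<exists>p\<in>nash_equilibria d G.
    real (social_cost G p) = real N * (\<Sum>k=2..S. real (card (code k)) / real ((k - 1) ^ d)))"
proof -
  define c where "c k = N div (k - 1) ^ d * card (code k)" for k
  \<comment> \<open>An item is a triple of its type, its homogeneous bin, and its word in that
    bin.\<close>
  define J where "J = (SIGMA k:{2..S}. {..<c k} \<times> words k)"
  define n where "n = card J"
  have "finite J" by (auto simp: J_def)
  then obtain e where e: "bij_betw e {..<n} J"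
    using ex_bij_betw_nat_finite[of J] by (auto simp: n_def atLeast0LessThan)
  define K where "K i = fst (e i)" for i
  define B where "B i = fst (snd (e i))" for i
  define W where "W i = snd (snd (e i))" for i
  have mem: "K i \<in> {2..S}" "B i < c (K i)" "W i \<in> words (K i)" if "i < n" for i
  proof -
    have "e i \<in> J" using e that by (auto simp: bij_betw_def)
    then show "K i \<in> {2..S}" "B i < c (K i)" "W i \<in> words (K i)"
      by (auto simp: J_def K_def B_def W_def)
  qed
  have inj: "i = j" if "i < n" "j < n" "K i = K j" "B i = B j" "W i = W j" for i j
  proof -
    have "e i = e j" using that by (simp add: K_def B_def W_def prod_eq_iff)
    then show ?thesis using e that by (auto simp: bij_betw_def dest: inj_onD)
  qed
  have surj: "\<exists>i<n. K i = k \<and> B i = b \<and> W i = w" if "k \<in> {2..S}" "b < c k" "w \<in> words k" for k b w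
  proof -
    have "(k, b, w) \<in> e ` {..<n}" using e that by (simp add: bij_betw_def J_def)
    then obtain i where "i < n" "e i = (k, b, w)" by force
    then show ?thesis by (auto simp: K_def B_def W_def)
  qed

  define G where "G = map (\<lambda>i. side (K i)) [0..<n]"
  have items: "items G = {..<n}" by (simp add: items_def G_def)
  have G: "G ! i = side (K i)" if "i < n" for i using that by (simp add: G_def)
  have games: "G \<in> games"
    using mem(1) side_pos side_le_1 by (auto simp: games_def G_def)
  have c_mult: "card ({..<c k} \<times> words k) = card ({..<N} \<times> code k)" if "k \<in> {2..S}" for k
    using dvd[OF that] by (simp add: c_def card_cartesian_product card_words mult.commute mult.left_commute)

  \<comment> \<open>Relabels the items of type \<open>k\<close> by an optimal bin and a codeword;
    equal cubes are interchangeable, so equal cardinalities suffice.\<close>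
  have "\<exists>\<psi>. bij_betw \<psi> ({..<c k} \<times> words k) ({..<N} \<times> code k)" if "k \<in> {2..S}" for k
    using c_mult[OF that] by (intro finite_same_card_bij) auto
  then obtain \<psi> where \<psi>: "\<And>k. k \<in> {2..S} \<Longrightarrow> bij_betw (\<psi> k) ({..<c k} \<times> words k) ({..<N} \<times> code k)"
    by metis
  define q where "q i = fst (\<psi> (K i) (B i, W i))" for i
  define V where "V i = snd (\<psi> (K i) (B i, W i))" for i
  have \<psi>_mem: "q i < N" "V i \<in> code (K i)" if "i < n" for i
  proof -
    have "\<psi> (K i) (B i, W i) \<in> {..<N} \<times> code (K i)"
      using mem[OF that] bij_betwE[OF \<psi>[OF mem(1)[OF that]]] by blast
    then show "q i < N" "V i \<in> code (K i)"
      by (auto simp: q_def V_def mem_Times_iff)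
  qed
  have q_inj: "i = j" if ij: "i < n" "j < n" "K i = K j" "q i = q j" "V i = V j" for i j
  proof -
    have "\<psi> (K i) (B i, W i) = \<psi> (K i) (B j, W j)"
      using ij by (simp add: q_def V_def prod_eq_iff)
    moreover have "inj_on (\<psi> (K i)) ({..<c (K i)} \<times> words (K i))"
      by (rule bij_betw_imp_inj_on[OF \<psi>[OF mem(1)[OF ij(1)]]])
    moreover have "(B i, W i) \<in> {..<c (K i)} \<times> words (K i)" "(B j, W j) \<in> {..<c (K i)} \<times> words (K i)"
      using mem[OF ij(1)] mem[OF ij(2)] ij(3) by auto
    ultimately have "(B i, W i) = (B j, W j)"
      by (meson inj_onD)
    then show ?thesis using inj ij by auto
  qed
  have q_conf: "q \<in> configurations d G"
    unfolding configurations_def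
  proof (intro CollectI allI)
    fix b
    have less: "i < n" if "i \<in> bin_items G q b" for i
      using that by (simp add: bin_items_def items)
    show "packable d G (bin_items G q b)"
    proof (rule packable_codes[where \<kappa> = K and f = V])
      show "G ! i = side (K i) \<and> K i \<in> {2..S} \<and> V i \<in> words (K i)" if "i \<in> bin_items G q b" for i
        using G mem(1) \<psi>_mem(2) code_subset less[OF that] by blast
      show "inj_on (\<lambda>i. (K i, V i)) (bin_items G q b)"
      proof (rule inj_onI)
        fix i j assume "i \<in> bin_items G q b" "j \<in> bin_items G q b" "(K i, V i) = (K j, V j)"
        then show "i = j" by (rule_tac q_inj) (auto simp: bin_items_def less)
      qed
      show "V j \<in> code (K j)" if "j \<in> bin_items G q b" for j
        using \<psi>_mem(2) less[OF that] .
    qed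
  qed

  \<comment> \<open>Cubes of type 2 have side above \<open>1 / 2\<close>, so no two of them share a
    bin. There are exactly \<open>N\<close> of them, because \<open>code 2\<close> is all of
    \<open>words 2\<close>, a single word.\<close>
  have OPT_ge: "N \<le> social_cost G r" if r: "r \<in> configurations d G" for r
  proof -
    define A where "A = {i. i < n \<and> K i = 2}"
    have A: "A \<subseteq> {..<n}" by (auto simp: A_def)
    have "bij_betw (\<lambda>i. (B i, W i)) A ({..<c 2} \<times> words 2)"
      unfolding bij_betw_def
    proof (intro conjI inj_onI set_eqI iffI)
      show "i = j" if "i \<in> A" "j \<in> A" "(B i, W i) = (B j, W j)" for i j
        using that by (rule_tac inj) (auto simp: A_def)
      show "x \<in> {..<c 2} \<times> words 2" if "x \<in> (\<lambda>i. (B i, W i)) ` A" for x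
        using that mem(2,3) unfolding A_def by force
      show "x \<in> (\<lambda>i. (B i, W i)) ` A" if "x \<in> {..<c 2} \<times> words 2" for x
        using that surj[of 2 "fst x" "snd x"] S_ge unfolding A_def by force
    qed
    then have "card A = card ({..<c 2} \<times> words 2)" by (rule bij_betw_same_card)
    also have "code 2 = words 2" by (auto simp: code_def)
    then have "card ({..<c 2} \<times> words 2) = N"
      using c_mult[of 2] S_ge by (simp add: card_cartesian_product card_words)
    finally have "card A = N" .
    moreover have "inj_on r A"
    proof (rule inj_onI, rule ccontr)
      fix i j assume ij: "i \<in> A" "j \<in> A" "r i = r j" "i \<noteq> j"
      have "packable d G (bin_items G r (r i))"
        using r by (simp add: configurations_def)
      moreover have "{i, j} \<subseteq> bin_items G r (r i)"
        using ij A by (auto simp: bin_items_def items)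
      ultimately have "packable d G {i, j}"
        by (rule packable_mono)
      moreover have "1 / real 2 < G ! m" if "m \<in> {i, j}" for m
      proof -
        have "m < n" "K m = 2" using that ij(1,2) by (auto simp: A_def)
        then show ?thesis using side_gt[of 2] by (simp add: G)
      qed
      ultimately have "card {i, j} \<le> (2 - 1) ^ d"
        by (intro packable_card_le) (blast, blast, rule zero_less_numeral)
      then show False using ij(4) by simp
    qed
    then have "card A \<le> card (r ` {..<n})"
      using A by (metis card_image card_mono finite_imageI finite_lessThan image_mono)
    ultimately show ?thesis by (simp add: social_cost_def items)
  qed
  have "social_cost G q \<le> N"
    using card_mono[of "{..<N}" "q ` {..<n}"] \<psi>_mem(1) by (auto simp: social_cost_def items)
  moreover have "OPT d G \<le> social_cost G q"
    unfolding OPT_def by (intro cINF_lower q_conf) simp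
  ultimately have "OPT d G \<le> N" by simp
  moreover have "N \<le> OPT d G"
    unfolding OPT_def using OPT_ge q_conf by (intro cINF_greatest) auto
  ultimately have OPT: "OPT d G = N" by simp

  define p where "p i = prod_encode (K i, B i)" for i
  have p_eq: "p i = p j \<longleftrightarrow> K i = K j \<and> B i = B j" for i j
    by (auto simp: p_def prod_encode_eq)
  have p_conf: "p \<in> configurations d G"
    unfolding configurations_def
  proof (intro CollectI allI)
    fix b
    have less: "i < n" "p i = b" if "i \<in> bin_items G p b" for i
      using that by (simp_all add: bin_items_def items)
    have same: "K i = K j \<and> B i = B j" if "i \<in> bin_items G p b" "j \<in> bin_items G p b" for i j
      using less(2)[OF that(1)] less(2)[OF that(2)] p_eq[of i j] by simp
    show "packable d G (bin_items G p b)"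
    proof (rule packable_codes[where \<kappa> = K and f = W])
      show "G ! i = side (K i) \<and> K i \<in> {2..S} \<and> W i \<in> words (K i)" if "i \<in> bin_items G p b" for i
        using G mem(1,3) less(1)[OF that] by blast
      show "inj_on (\<lambda>i. (K i, W i)) (bin_items G p b)"
      proof (rule inj_onI)
        fix i j assume "i \<in> bin_items G p b" "j \<in> bin_items G p b" "(K i, W i) = (K j, W j)"
        then show "i = j" using same[of i j] by (rule_tac inj) (auto simp: less(1))
      qed
      show "W j \<in> code (K j)" if "i \<in> bin_items G p b" "j \<in> bin_items G p b" "K i < K j" for i j
        using same[OF that(1,2)] that(3) by simp
    qed
  qed

  have bin_card: "card (bin_items G p (p i)) = (K i - 1) ^ d" if i: "i < n" for i
  proof -
    have "bij_betw W (bin_items G p (p i)) (words (K i))"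
      unfolding bij_betw_def
    proof (intro conjI inj_onI set_eqI iffI)
      show "j = k" if "j \<in> bin_items G p (p i)" "k \<in> bin_items G p (p i)" "W j = W k" for j k
        using that by (rule_tac inj) (auto simp: bin_items_def items p_eq)
      show "x \<in> words (K i)" if "x \<in> W ` bin_items G p (p i)" for x
        using that mem(3) by (force simp: bin_items_def items p_eq)
      show "x \<in> W ` bin_items G p (p i)" if "x \<in> words (K i)" for x
        using surj[OF mem(1,2)[OF i] that] by (force simp: bin_items_def items p_eq)
    qed
    then show ?thesis by (simp add: bij_betw_same_card card_words)
  qed
  have vol: "volume d G i = side (K i) ^ d" if "i < n" for i
    using that by (simp add: volume_def G)
  have vol_pos: "0 < volume d G i" if "i < n" for i
    using that mem(1)[OF that] side_pos by (simp add: vol)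
  have bin_volume: "(\<Sum>j\<in>bin_items G p (p i). volume d G j) = real ((K i - 1) ^ d) * side (K i) ^ d"
    if i: "i < n" for i
  proof -
    have "(\<Sum>j\<in>bin_items G p (p i). volume d G j) = (\<Sum>j\<in>bin_items G p (p i). side (K i) ^ d)"
      by (intro sum.cong) (auto simp: bin_items_def items p_eq vol)
    then show ?thesis by (simp add: bin_card[OF i])
  qed
  have "p \<in> nash_equilibria d G"
    unfolding nash_equilibria_def
  proof (intro CollectI conjI p_conf notI, elim bexE exE conjE)
    fix i b
    assume "i \<in> items G" and b: "b \<noteq> p i" and fits: "packable d G (insert i (bin_items G p b))"
      and better: "cost d G (p(i := b)) i < cost d G p i"
    then have i: "i < n" by (simp add: items)
    have fin: "finite (bin_items G p b')" for b' by (simp add: bin_items_def items)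
    have notin: "i \<notin> bin_items G p b" using b by (simp add: bin_items_def)
    have "bin_items G (p(i := b)) b = insert i (bin_items G p b)"
      using i by (auto simp: bin_items_def items)
    then have new: "cost d G (p(i := b)) i =
        volume d G i / (volume d G i + (\<Sum>j\<in>bin_items G p b. volume d G j))"
      using notin fin by (simp add: cost_def)
    have nonneg: "0 \<le> (\<Sum>j\<in>bin_items G p b. volume d G j)"
      using vol_pos by (intro sum_nonneg) (auto simp: bin_items_def items intro: less_imp_le)
    \<comment> \<open>As the cost is inversely proportional to the total volume in the bin, it
      suffices that the target bin does not become fuller than the present one.\<close>
    have "volume d G i + (\<Sum>j\<in>bin_items G p b. volume d G j)
        \<le> (\<Sum>j\<in>bin_items G p (p i). volume d G j)"
    proof (cases "bin_items G p b = {}")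
      case True
      have "i \<in> bin_items G p (p i)" using i by (simp add: bin_items_def items)
      then have "volume d G i \<le> (\<Sum>j\<in>bin_items G p (p i). volume d G j)"
        using fin vol_pos by (intro member_le_sum) (auto simp: bin_items_def items intro: less_imp_le)
      then show ?thesis by (simp add: True)
    next
      case False
      then obtain j where j: "j < n" "p j = b" by (auto simp: bin_items_def items)
      \<comment> \<open>Otherwise all cubes of the target bin and the moving one have side above
        \<open>1 / K j\<close>, but that bin already holds the maximal number
        \<open>(K j - 1) ^ d\<close>.\<close>
      have "K j < K i"
      proof (rule ccontr)
        assume "\<not> K j < K i"
        then have ge: "side (K j) \<le> side (K i)" using mem(1)[OF i] by (intro side_antimono) auto
        have "1 / real (K j) < G ! m" if m: "m \<in> insert i (bin_items G p b)" for m
        proof -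
          have "side (K j) \<le> side (K m)" "m < n"
            using m ge i j by (auto simp: bin_items_def items p_eq)
          then show ?thesis using side_gt[of "K j"] mem(1)[OF j(1)] by (simp add: G)
        qed
        then have "card (insert i (bin_items G p b)) \<le> (K j - 1) ^ d"
          using fits mem(1)[OF j(1)] by (intro packable_card_le) auto
        then show False using notin fin bin_card[OF j(1)] j(2) by simp
      qed
      then show ?thesis
        using move_unprofitable[of "K j" "K i"] mem(1)[OF j(1)] bin_volume[OF i] bin_volume[OF j(1)] j(2)
        by (simp add: vol[OF i])
    qed
    then have "cost d G p i \<le> cost d G (p(i := b)) i"
      unfolding new unfolding cost_def
      using vol_pos[OF i] nonneg by (intro divide_left_mono mult_pos_pos) linarith+
    then show False using better by simp
  qed
  moreover have "real (social_cost G p) =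
      real N * (\<Sum>k=2..S. real (card (code k)) / real ((k - 1) ^ d))"
  proof -
    \<comment> \<open>Every label in the range is used, since a homogeneous bin contains at least
      one word.\<close>
    have "p ` {..<n} = prod_encode ` (SIGMA k:{2..S}. {..<c k})"
    proof (intro equalityI subsetI)
      fix x assume "x \<in> p ` {..<n}"
      then show "x \<in> prod_encode ` (SIGMA k:{2..S}. {..<c k})" using mem by (auto simp: p_def)
    next
      fix x assume "x \<in> prod_encode ` (SIGMA k:{2..S}. {..<c k})"
      then obtain k b where kb: "k \<in> {2..S}" "b < c k" "x = prod_encode (k, b)" by auto
      then have "0 < card (words k)" by (simp add: card_words)
      then obtain w where "w \<in> words k" by (metis card.empty less_irrefl ex_in_conv)
      then show "x \<in> p ` {..<n}" using surj[OF kb(1,2)] kb(3) by (force simp: p_def)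
    qed
    then have "social_cost G p = (\<Sum>k=2..S. c k)"
      by (simp add: social_cost_def items card_image inj_prod_encode)
    moreover have "real (c k) = real N * (real (card (code k)) / real ((k - 1) ^ d))"
      if "k \<in> {2..S}" for k
      using dvd[OF that] unfolding c_def by (simp add: real_of_nat_div del: of_nat_power)
    ultimately show ?thesis by (simp add: sum_distrib_left del: of_nat_power)
  qed
  ultimately show ?thesis using games OPT by blast
qed

text \<open>The ratio in \<open>ex_nash_game\<close> does not depend on \<open>N\<close>, and
  suitable \<open>N\<close> are arbitrarily large, so the limit superior inherits the bound.\<close>

lemma PoA_ge:
  "ereal (\<Sum>k=2..S. real (card (code k)) / real ((k - 1) ^ d)) \<le> PoA d"
  unfolding PoA_def limsup_INF_SUP
proof (rule INF_greatest)
  fix m0 :: nat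
  define P where "P = (\<Prod>k=2..S. (k - 1) ^ d)"
  define N where "N = Suc m0 * P"
  have "0 < P" by (auto simp: P_def intro!: prod_pos)
  then have "m0 \<le> N" "0 < N" by (cases P; simp add: N_def)+
  have "(k - 1) ^ d dvd N" if "k \<in> {2..S}" for k
    unfolding N_def P_def using that by (intro dvd_mult dvd_prodI) auto
  then obtain G p where G: "G \<in> games" "OPT d G = N" "p \<in> nash_equilibria d G"
    and cost: "real (social_cost G p) = real N * (\<Sum>k=2..S. real (card (code k)) / real ((k - 1) ^ d))"
    using ex_nash_game by blast
  have "ereal (\<Sum>k=2..S. real (card (code k)) / real ((k - 1) ^ d)) =
      ereal (real (social_cost G p) / real N)"
    unfolding cost using \<open>0 < N\<close> by simp
  also have "\<dots> \<le> (SUP G\<in>{G \<in> games. OPT d G = N}.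
      SUP p\<in>nash_equilibria d G. ereal (real (social_cost G p) / real N))"
    using G by (intro SUP_upper2[of G] SUP_upper) auto
  finally show "ereal (\<Sum>k=2..S. real (card (code k)) / real ((k - 1) ^ d)) \<le>
      (SUP m\<in>{m0..}. SUP G\<in>{G \<in> games. OPT d G = m}.
        SUP p\<in>nash_equilibria d G. ereal (real (social_cost G p) / real m))"
    using \<open>m0 \<le> N\<close> by (intro SUP_upper2[of N]) auto
qed

section \<open>Size of the codes\<close>

text \<open>Union bound over the smaller types \<open>j\<close>: a word fails against
  \<open>j\<close> only if it avoids the last slot on all of \<open>T k - T j\<close>, and each such
  coordinate keeps a fraction \<open>(k - 2) / (k - 1) \<le> 1 - 1 / S\<close> of the words.\<close>

lemma card_code_ge:
  assumes k: "2 \<le> k" "k \<le> S" and D: "\<And>j. j \<in> {2..<k} \<Longrightarrow> D \<le> card ({..<d} \<inter> (T k - T j))"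
  shows "1 - real S * (1 - 1 / real S) ^ D \<le> real (card (code k)) / real ((k - 1) ^ d)"
proof -
  define X where "X j = {..<d} \<inter> (T k - T j)" for j
  define bad where "bad j = ({..<d} \<rightarrow>\<^sub>E {..<k - 1}) \<inter> {v. \<forall>i\<in>X j. v i \<noteq> k - 2}" for j
  define \<beta> where "\<beta> = 1 - 1 / real S"
  have \<beta>: "0 \<le> \<beta>" "\<beta> \<le> 1" using S_ge by (auto simp: \<beta>_def)
  have bad: "real (card (bad j)) \<le> real ((k - 1) ^ d) * \<beta> ^ D" if j: "j \<in> {2..<k}" for j
  proof -
    have "bad j \<subseteq> (\<Pi>\<^sub>E i\<in>{..<d}. if i \<in> X j then {..<k - 2} else {..<k - 1})"
    proof
      fix v assume v: "v \<in> bad j"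
      have "v i \<in> (if i \<in> X j then {..<k - 2} else {..<k - 1})" if "i < d" for i
      proof -
        have "v i < k - 1" "i \<in> X j \<Longrightarrow> v i \<noteq> k - 2" using v that by (auto simp: bad_def)
        then show ?thesis by auto
      qed
      then show "v \<in> (\<Pi>\<^sub>E i\<in>{..<d}. if i \<in> X j then {..<k - 2} else {..<k - 1})"
        using v by (auto simp: bad_def PiE_iff)
    qed
    then have "card (bad j) \<le> card (\<Pi>\<^sub>E i\<in>{..<d}. if i \<in> X j then {..<k - 2} else {..<k - 1})"
      by (intro card_mono finite_PiE) auto
    also have "\<dots> = (\<Prod>i<d. if i \<in> X j then k - 2 else k - 1)"
      by (subst card_PiE) (auto intro!: prod.cong)
    finally have "real (card (bad j)) \<le> (\<Prod>i<d. real (if i \<in> X j then k - 2 else k - 1))"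
      by (metis of_nat_le_iff of_nat_prod)
    also have "\<dots> \<le> (\<Prod>i<d. real (k - 1) * (if i \<in> X j then \<beta> else 1))"
    proof (intro prod_mono conjI)
      fix i
      have "real (k - 1) * (1 / real S) \<le> 1" using k by (simp add: of_nat_diff field_simps)
      then have "real (k - 2) \<le> real (k - 1) * \<beta>"
        using k by (simp add: \<beta>_def of_nat_diff algebra_simps)
      then show "real (if i \<in> X j then k - 2 else k - 1) \<le> real (k - 1) * (if i \<in> X j then \<beta> else 1)"
        by simp
    qed auto
    also have "\<dots> = real ((k - 1) ^ d) * \<beta> ^ card (X j)"
    proof -
      have "{..<d} \<inter> X j = X j" by (auto simp: X_def)
      then show ?thesis unfolding prod.distrib by (simp add: prod.If_cases)
    qed
    also have "\<dots> \<le> real ((k - 1) ^ d) * \<beta> ^ D"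
      using D[OF j] \<beta> by (intro mult_left_mono power_decreasing) (auto simp: X_def)
    finally show ?thesis .
  qed
  have "words k \<subseteq> code k \<union> (\<Union>j\<in>{2..<k}. bad j)"
    by (auto simp: code_def bad_def words_def X_def)
  then have "card (words k) \<le> card (code k \<union> (\<Union>j\<in>{2..<k}. bad j))"
    by (intro card_mono) (auto simp: bad_def intro!: finite_PiE)
  also have "\<dots> \<le> card (code k) + (\<Sum>j=2..<k. card (bad j))"
    by (rule order_trans[OF card_Un_le]) (auto intro: card_UN_le)
  finally have "real ((k - 1) ^ d) \<le> real (card (code k)) + (\<Sum>j=2..<k. real (card (bad j)))"
    unfolding card_words by (metis of_nat_le_iff of_nat_add of_nat_sum)
  also have "(\<Sum>j=2..<k. real (card (bad j))) \<le> (\<Sum>j=2..<k. real ((k - 1) ^ d) * \<beta> ^ D)"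
    by (intro sum_mono bad)
  also have "\<dots> = real (k - 2) * (real ((k - 1) ^ d) * \<beta> ^ D)"
    by (simp del: of_nat_power)
  also have "\<dots> \<le> real S * (real ((k - 1) ^ d) * \<beta> ^ D)"
    using k \<beta> by (intro mult_right_mono) auto
  finally have "real ((k - 1) ^ d) * (1 - real S * \<beta> ^ D) \<le> real (card (code k))"
    by (simp add: algebra_simps)
  moreover have "0 < real ((k - 1) ^ d)" using k by simp
  ultimately show ?thesis
    unfolding \<beta>_def by (simp add: pos_le_divide_eq mult.commute del: of_nat_power)
qed

end

section \<open>Walsh functions\<close>

text \<open>The sign is the parity of the number of common binary ones of \<open>k\<close> and
  \<open>x\<close> among the lowest \<open>r\<close> digits; these are the rows of the
  Sylvester-Hadamard matrix.\<close>

fun walsh :: "nat \<Rightarrow> nat \<Rightarrow> nat \<Rightarrow> int" where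
  "walsh 0 k x = 1"
| "walsh (Suc r) k x = (if odd k \<and> odd x then -1 else 1) * walsh r (k div 2) (x div 2)"

lemma walsh_0 [simp]: "walsh r 0 x = 1"
  by (induction r arbitrary: x) auto

lemma walsh_cases: "walsh r k x = 1 \<or> walsh r k x = -1"
  by (induction r arbitrary: k x) auto

lemma sum_double_range:
  fixes f :: "nat \<Rightarrow> 'a :: comm_monoid_add"
  shows "(\<Sum>x<2 * n. f x) = (\<Sum>y<n. f (2 * y) + f (2 * y + 1))"
  by (induction n) (auto simp: add.assoc)

lemma walsh_orthogonal:
  assumes "k < 2 ^ r" "l < 2 ^ r" "k \<noteq> l"
  shows "(\<Sum>x<2 ^ r. walsh r k x * walsh r l x) = 0"
  using assms
proof (induction r arbitrary: k l)
  case (Suc r)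
  \<comment> \<open>Summing over the lowest digit of \<open>x\<close> gives cancellation if the
    lowest digits of \<open>k\<close> and \<open>l\<close> differ, and a factor 2 otherwise.\<close>
  define c where "c = (if odd k \<noteq> odd l then 0 else 2 :: int)"
  have "(\<Sum>x<2 ^ Suc r. walsh (Suc r) k x * walsh (Suc r) l x) =
      (\<Sum>y<2 ^ r. c * (walsh r (k div 2) y * walsh r (l div 2) y))"
    unfolding power_Suc sum_double_range by (intro sum.cong) (auto simp: c_def)
  also have "\<dots> = c * (\<Sum>y<2 ^ r. walsh r (k div 2) y * walsh r (l div 2) y)"
    by (simp add: sum_distrib_left)
  also have "\<dots> = 0"
  proof (cases "odd k = odd l")
    case True
    then have "k div 2 \<noteq> l div 2" using Suc.prems
      by (metis dvd_mult_div_cancel odd_two_times_div_two_succ)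
    then show ?thesis using Suc by (simp add: less_mult_imp_div_less)
  qed (simp add: c_def)
  finally show ?case .
qed auto

lemma card_walsh_difference:
  assumes "0 < k" "k < 2 ^ r" "0 < l" "l < 2 ^ r" "k \<noteq> l"
  shows "4 * card {x. x < 2 ^ r \<and> walsh r l x = -1 \<and> walsh r k x = 1} = 2 ^ r"
proof -
  let ?P = "\<lambda>x. walsh r l x = -1 \<and> walsh r k x = 1"
  have zero: "(\<Sum>x<2 ^ r. walsh r j x) = 0" if "0 < j" "j < 2 ^ r" for j
    using walsh_orthogonal[of j r 0] that by simp
  have "4 * int (card {x. x < 2 ^ r \<and> ?P x}) = (\<Sum>x<2 ^ r. if ?P x then 4 else 0)"
    by (simp add: sum.If_cases Int_def)
  \<comment> \<open>Four times the indicator is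
    \<open>(1 - walsh r l x) * (1 + walsh r k x)\<close>. After expansion only the constant term
    survives summation, by orthogonality to each other and to \<open>walsh r 0\<close>.\<close>
  also have "\<dots> = (\<Sum>x<2 ^ r. 1 - walsh r l x + walsh r k x - walsh r l x * walsh r k x)"
    using walsh_cases[of r l] walsh_cases[of r k] by (intro sum.cong) force+
  also have "\<dots> = 2 ^ r"
    using zero assms walsh_orthogonal[of l r k] by (simp add: sum.distrib sum_subtractf)
  finally have "int (4 * card {x. x < 2 ^ r \<and> ?P x}) = int (2 ^ r)"
    by (simp only: of_nat_mult of_nat_numeral of_nat_power)
  then show ?thesis by (simp only: of_nat_eq_iff)
qed

lemma card_periodic:
  assumes "0 < n"
  shows "card {i. i < q * n \<and> P (i mod n)} = q * card {x. x < n \<and> P x}"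
proof (induction q)
  case (Suc q)
  have "{i. i < Suc q * n \<and> P (i mod n)} =
      {i. i < q * n \<and> P (i mod n)} \<union> (\<lambda>x. q * n + x) ` {x. x < n \<and> P x}"
  proof (intro set_eqI iffI)
    fix i assume i: "i \<in> {i. i < Suc q * n \<and> P (i mod n)}"
    show "i \<in> {i. i < q * n \<and> P (i mod n)} \<union> (\<lambda>x. q * n + x) ` {x. x < n \<and> P x}"
    proof (cases "i < q * n")
      case False
      then obtain x where x: "i = q * n + x" by (metis le_iff_add not_less)
      with i have "x < n" "P x" by auto
      then show ?thesis using x by auto
    qed (use i in auto)
  qed auto
  moreover have "card ((\<lambda>x. q * n + x) ` {x. x < n \<and> P x}) = card {x. x < n \<and> P x}"
    by (intro card_image) (auto simp: inj_on_def)
  moreover have "card ({i. i < q * n \<and> P (i mod n)} \<union> (\<lambda>x. q * n + x) ` {x. x < n \<and> P x}) =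
      card {i. i < q * n \<and> P (i mod n)} + card ((\<lambda>x. q * n + x) ` {x. x < n \<and> P x})"
    by (intro card_Un_disjoint) auto
  ultimately show ?case
    using Suc by simp
qed auto

text \<open>Walsh functions are repeated periodically along the coordinates. Full periods contribute
  exactly a quarter; the incomplete one has fewer than \<open>2 * S\<close> coordinates, which costs
  at most \<open>S / 2\<close>.\<close>

lemma ex_difference_family:
  assumes "2 \<le> S"
  shows "\<exists>T :: nat \<Rightarrow> nat set. \<forall>k\<in>{2..S}. \<forall>j\<in>{2..<k}.
    real d / 4 - real S / 2 \<le> real (card ({..<d} \<inter> (T k - T j)))"
proof -
  obtain n where "2 ^ n < S" "S \<le> 2 ^ (n + 1)"
    using ex_power_ivl2[of 2 S] assms by auto
  then obtain r :: nat where r: "S \<le> 2 ^ r" "2 ^ r < 2 * S"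
    by (metis Suc_eq_plus1 mult_less_cancel1 power_Suc zero_less_numeral)
  \<comment> \<open>The shift to \<open>k - 1\<close> keeps the index below \<open>2 ^ r\<close>
    even for \<open>k = S = 2 ^ r\<close>; it stays positive, so the constant function is
    avoided.\<close>
  define T where "T k = {i. walsh r (k - 1) (i mod 2 ^ r) = -1}" for k
  have "real d / 4 - real S / 2 \<le> real (card ({..<d} \<inter> (T k - T j)))"
    if kj: "k \<in> {2..S}" "j \<in> {2..<k}" for k j
  proof -
    define P where "P x \<longleftrightarrow> walsh r (k - 1) x = -1 \<and> walsh r (j - 1) x = 1" for x
    define q where "q = d div 2 ^ r"
    have d: "d < q * 2 ^ r + 2 ^ r"
      unfolding q_def by (metis add_strict_left_mono div_mult_mod_eq mod_less_divisor zero_less_numeral zero_less_power)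
    have "0 < j - 1" "j - 1 < 2 ^ r" "0 < k - 1" "k - 1 < 2 ^ r" "j - 1 \<noteq> k - 1"
      using kj r(1) by auto
    then have "4 * card {x. x < 2 ^ r \<and> P x} = 2 ^ r"
      unfolding P_def by (rule card_walsh_difference)
    then have "q * 2 ^ r = 4 * (q * card {x. x < 2 ^ r \<and> P x})"
      by (metis mult.left_commute)
    also have "q * card {x. x < 2 ^ r \<and> P x} = card {i. i < q * 2 ^ r \<and> P (i mod 2 ^ r)}"
      by (rule card_periodic[symmetric]) simp
    also have "\<dots> \<le> card ({..<d} \<inter> (T k - T j))"
    proof (rule card_mono)
      have "q * 2 ^ r \<le> d" by (simp add: q_def)
      then show "{i. i < q * 2 ^ r \<and> P (i mod 2 ^ r)} \<subseteq> {..<d} \<inter> (T k - T j)"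
        by (auto simp: P_def T_def)
    qed simp
    finally have "d < 4 * card ({..<d} \<inter> (T k - T j)) + 2 * S"
      using d r(2) by linarith
    then have "real d < real (4 * card ({..<d} \<inter> (T k - T j)) + 2 * S)"
      by (simp only: of_nat_less_iff)
    then show ?thesis by simp
  qed
  then show ?thesis by blast
qed

section \<open>Choice of the parameters\<close>

lemma PoA_ge_explicit:
  assumes d: "2 \<le> d" and S: "2 \<le> S"
  shows "ereal ((real S - 1) * (1 - real S * exp (1 / 2 - real d / (4 * real S)))) \<le> PoA d"
proof -
  obtain T :: "nat \<Rightarrow> nat set" where T: "\<And>k j. k \<in> {2..S} \<Longrightarrow> j \<in> {2..<k} \<Longrightarrow>
      real d / 4 - real S / 2 \<le> real (card ({..<d} \<inter> (T k - T j)))"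
    using ex_difference_family[OF S] by metis
  interpret cube_codes d S T by unfold_locales (fact d S)+
  \<comment> \<open>If the lower bound is negative, \<open>nat\<close> turns it into 0, which is
    still admissible.\<close>
  define D where "D = nat \<lceil>real d / 4 - real S / 2\<rceil>"
  have D: "D \<le> card ({..<d} \<inter> (T k - T j))" if "k \<in> {2..S}" "j \<in> {2..<k}" for k j
    using T[OF that] unfolding D_def by linarith
  have "(1 - 1 / real S) ^ D \<le> exp (- (1 / real S)) ^ D"
    using S exp_ge_add_one_self[of "- (1 / real S)"] by (intro power_mono) auto
  also have "\<dots> = exp (- (real D / real S))"
    by (simp add: exp_of_nat_mult[symmetric])
  also have "\<dots> \<le> exp (1 / 2 - real d / (4 * real S))"
  proof -
    have "real d / 4 - real S / 2 \<le> real D" unfolding D_def by linarith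
    then have "(real d / 4 - real S / 2) / real S \<le> real D / real S"
      by (intro divide_right_mono) auto
    then show ?thesis using S by (simp add: diff_divide_distrib)
  qed
  finally have "1 - real S * exp (1 / 2 - real d / (4 * real S)) \<le>
      1 - real S * (1 - 1 / real S) ^ D"
    by (intro diff_left_mono mult_left_mono) auto
  also have "\<dots> \<le> real (card (code k)) / real ((k - 1) ^ d)" if "k \<in> {2..S}" for k
    using that D by (intro card_code_ge) auto
  finally have "(\<Sum>k=2..S. 1 - real S * exp (1 / 2 - real d / (4 * real S))) \<le>
      (\<Sum>k=2..S. real (card (code k)) / real ((k - 1) ^ d))"
    by (intro sum_mono)
  then have "(real S - 1) * (1 - real S * exp (1 / 2 - real d / (4 * real S))) \<le>
      (\<Sum>k=2..S. real (card (code k)) / real ((k - 1) ^ d))"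
    using S by (simp add: of_nat_diff del: of_nat_power)
  then show ?thesis
    using PoA_ge order_trans ereal_less_eq(3) by blast
qed

theorem theorem2:
  "\<exists>d0::nat. \<forall>d\<ge>d0. PoA d \<ge> ereal (real d / (5 * ln (real d)))"
proof -
  \<comment> \<open>With \<open>x = d / (c * ln d)\<close> and \<open>c = 9/2\<close> the
    exponential factor is of order \<open>d powr (- 9/8)\<close>, which beats the factor
    \<open>x\<close>; the constants suffice because
    \<open>2/9 * 19/20 = 19/90 > 1/5\<close>.\<close>
  define x where "x d = 2 * real d / (9 * ln (real d))" for d :: nat
  have "eventually (\<lambda>d. 3 \<le> x d) at_top"
    unfolding x_def by real_asymp
  moreover have "eventually (\<lambda>d. x d * exp (1 / 2 - 9 / 8 * ln (real d)) \<le> 1 / 20) at_top"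
    unfolding x_def by real_asymp
  moreover have "eventually (\<lambda>d. real d / (5 * ln (real d)) \<le> (x d - 2) * (19 / 20)) at_top"
    unfolding x_def by real_asymp
  ultimately have "eventually (\<lambda>d. ereal (real d / (5 * ln (real d))) \<le> PoA d) at_top"
    using eventually_ge_at_top[of 2]
  proof eventually_elim
    case (elim d)
    \<comment> \<open>Rounding down and the absence of type 1 cost at most 2 in total, hence the
      factor \<open>x d - 2\<close>.\<close>
    define S where "S = nat \<lfloor>x d\<rfloor>"
    have S: "real S \<le> x d" "x d - 1 \<le> real S" "2 \<le> S"
      using elim(1) unfolding S_def by linarith+
    have "9 / 8 * ln (real d) = real d / (4 * x d)"
      using elim(4) by (simp add: x_def)
    also have "\<dots> \<le> real d / (4 * real S)"
      using S by (intro divide_left_mono) auto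
    finally have "real S * exp (1 / 2 - real d / (4 * real S)) \<le>
        x d * exp (1 / 2 - 9 / 8 * ln (real d))"
      using S by (intro mult_mono) auto
    then have "19 / 20 \<le> 1 - real S * exp (1 / 2 - real d / (4 * real S))"
      using elim(2) by linarith
    then have "(x d - 2) * (19 / 20) \<le>
        (real S - 1) * (1 - real S * exp (1 / 2 - real d / (4 * real S)))"
      using S elim(1) by (intro mult_mono) auto
    then have "real d / (5 * ln (real d)) \<le>
        (real S - 1) * (1 - real S * exp (1 / 2 - real d / (4 * real S)))"
      using elim(3) by linarith
    then show ?case
      using PoA_ge_explicit[OF elim(4) S(3)] order_trans ereal_less_eq(3) by blast
  qed
  then show ?thesis by (simp add: eventually_at_top_linorder)
qed

end
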